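(* Let $f:\mathbb{R}^{n+m}\to\mathbb{R}$ be a $C^2$ function such that $\nabla f$ is globally Lipschitz with constant $L>0$ and the Hessian $\nabla^2 f(z)$ is invertible for all $z\in\mathbb{R}^{n+m}$. For $s>0$ let $w_s(z)=z-s(\nabla F(z))^{-1}F(z)$ (Damped Newton). Let $W_s$ be either $W_s(z)=-(\nabla F(z))^{-1}F(z)$ or, when $f$ is $C^3$, $$W_s(z)=-(\nabla F(z))^{-1}F(z)+\tfrac{s}{2}\Big((\nabla F(z))^{-1}\nabla^2F(z)(\nabla F(z))^{-1}F(z)-I\Big)(\nabla F(z))^{-1}F(z),$$ and assume that $w_s$ and $W_s$ are $C^1$ and satisfy the one-step consistency condition: there is an integer $r\ge2$ such that for every $z_0\in\mathbb{R}^{n+m}$, $|Z(s;z_0)-w_s(z_0)|\le O(s^r)$, where $Z(s;z_0)$ is the solution of $\dot Z=W_s(Z)$ at time $s$ with $Z(0)=z_0$. Then there exists $s^\ast>0$ such that for all $s\in(0,s^\ast)$, the set of saddle points of $f$ is a subset of the set of exponentially stable equilibria of $z_{k+1}=z_k-s(\nabla F(z_k))^{-1}F(z_k)$.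
   Context: Write $z=(x,y)\in\mathbb{R}^n\times\mathbb{R}^m$. A (local) saddle point of $f$ is a point $(x^\ast,y^\ast)$ having a neighbourhood $U$ such that $f(x^\ast,y)\le f(x^\ast,y^\ast)\le f(x,y^\ast)$ for all $(x,y)\in U$. Notation: $F(z)=\begin{bmatrix}\nabla_x f(z)\\-\nabla_y f(z)\end{bmatrix}$; $\nabla F$ is the Jacobian matrix of $F$; $\nabla^2F(z)$ is the second derivative (a symmetric bilinear map), and for a vector $u$ the expression $(\nabla F(z))^{-1}\nabla^2F(z)u$ denotes the matrix $v\mapsto(\nabla F(z))^{-1}\,\nabla^2F(z)[v,u]$ (above $u=(\nabla F(z))^{-1}F(z)$). "$\le O(s^r)$" means: for the given $z_0$ there are $C\ge0$, $s_0>0$ with the left-hand side at most $Cs^r$ for all $s\in(0,s_0]$. The two choices of $W_s$ are the right-hand sides of the $O(1)$- and $O(s)$-resolution ODEs of Damped Newton. An equilibrium (fixed point) $z^e$ of $z_{k+1}=w_s(z_k)$ is exponentially stable (meant locally) if it is stable (for every $\varepsilon>0$ there is $\delta>0$ such that $|z_0-z^e|<\delta$ implies $|z_k-z^e|<\varepsilon$ for all $k\ge0$) and there exist $\delta>0$, $M>0$, $\gamma\in(0,1)$ such that $|z_0-z^e|<\delta$ implies $|z_k-z^e|\le M|z_0-z^e|\gamma^k$ for all $k\ge0$. *)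

theory Defs
  imports "HOL-Analysis.Analysis"
begin

section \<open>Calculus on \<open>\<real>\<^sup>N\<close>\<close>

primrec C_k :: "nat \<Rightarrow> ('a::euclidean_space \<Rightarrow> 'b::euclidean_space) \<Rightarrow> bool" where
  "C_k 0 g \<longleftrightarrow> continuous_on UNIV g"
| "C_k (Suc k) g \<longleftrightarrow>
     (\<forall>z. g differentiable (at z)) \<and> (\<forall>v. C_k k (\<lambda>z. frechet_derivative g (at z) v))"

definition gradient :: "('a::euclidean_space \<Rightarrow> real) \<Rightarrow> 'a \<Rightarrow> 'a" where
  "gradient f z = (THE D. GDERIV f z :> D)"

definition jacobian :: "(real ^ 'k \<Rightarrow> real ^ 'l) \<Rightarrow> real ^ 'k \<Rightarrow> real ^ 'k ^ 'l" where
  "jacobian G z = matrix (frechet_derivative G (at z))"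

definition hessian :: "(real ^ 'k \<Rightarrow> real) \<Rightarrow> real ^ 'k \<Rightarrow> real ^ 'k ^ 'k" where
  "hessian f z = jacobian (gradient f) z"

text \<open>The value \<open>\<nabla>\<^sup>2G(z)[v,u]\<close>: the derivative of \<open>z \<mapsto> \<nabla>G(z) v\<close> in direction \<open>u\<close>.\<close>
definition second_deriv ::
    "(real ^ 'k \<Rightarrow> real ^ 'l) \<Rightarrow> real ^ 'k \<Rightarrow> real ^ 'k \<Rightarrow> real ^ 'k \<Rightarrow> real ^ 'l" where
  "second_deriv G z v u = frechet_derivative (\<lambda>z'. jacobian G z' *v v) (at z) u"

section \<open>The splitting \<open>z = (x, y)\<close> and saddle points\<close>

text \<open>A point of \<open>\<real>\<^sup>n\<^sup>+\<^sup>m\<close> is a vector indexed by the disjoint sum of the index types of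
  the \<open>x\<close>-block (\<open>Inl\<close>) and the \<open>y\<close>-block (\<open>Inr\<close>), so that Jacobians are ordinary matrices.\<close>

definition join :: "real ^ 'n::finite \<Rightarrow> real ^ 'm::finite \<Rightarrow> real ^ ('n + 'm)" where
  "join x y = (\<chi> k. case k of Inl i \<Rightarrow> x $ i | Inr j \<Rightarrow> y $ j)"

definition xpart :: "real ^ ('n::finite + 'm::finite) \<Rightarrow> real ^ 'n" where
  "xpart z = (\<chi> i. z $ Inl i)"

definition ypart :: "real ^ ('n::finite + 'm::finite) \<Rightarrow> real ^ 'm" where
  "ypart z = (\<chi> j. z $ Inr j)"

definition grad_x :: "(real ^ ('n::finite + 'm::finite) \<Rightarrow> real) \<Rightarrow> real ^ ('n + 'm) \<Rightarrow> real ^ 'n" where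
  "grad_x f z = gradient (\<lambda>x. f (join x (ypart z))) (xpart z)"

definition grad_y :: "(real ^ ('n::finite + 'm::finite) \<Rightarrow> real) \<Rightarrow> real ^ ('n + 'm) \<Rightarrow> real ^ 'm" where
  "grad_y f z = gradient (\<lambda>y. f (join (xpart z) y)) (ypart z)"

definition saddle_field :: "(real ^ ('n::finite + 'm::finite) \<Rightarrow> real) \<Rightarrow> real ^ ('n + 'm) \<Rightarrow> real ^ ('n + 'm)" where
  "saddle_field f z = join (grad_x f z) (- grad_y f z)"

definition saddle_point :: "(real ^ ('n::finite + 'm::finite) \<Rightarrow> real) \<Rightarrow> real ^ ('n + 'm) \<Rightarrow> bool" where
  "saddle_point f zs \<longleftrightarrow>
     (\<exists>U. open U \<and> zs \<in> U \<and>
       (\<forall>x y. join x y \<in> U \<longrightarrow>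
          f (join (xpart zs) y) \<le> f zs \<and> f zs \<le> f (join x (ypart zs))))"

section \<open>Damped Newton and its resolution ODEs\<close>

definition newton_dir :: "(real ^ ('n::finite + 'm::finite) \<Rightarrow> real) \<Rightarrow> real ^ ('n + 'm) \<Rightarrow> real ^ ('n + 'm)" where
  "newton_dir f z = matrix_inv (jacobian (saddle_field f) z) *v saddle_field f z"

definition newton_step ::
    "(real ^ ('n::finite + 'm::finite) \<Rightarrow> real) \<Rightarrow> real \<Rightarrow> real ^ ('n + 'm) \<Rightarrow> real ^ ('n + 'm)" where
  "newton_step f s z = z - s *\<^sub>R newton_dir f z"

definition ode_order_1 ::
    "(real ^ ('n::finite + 'm::finite) \<Rightarrow> real) \<Rightarrow> real \<Rightarrow> real ^ ('n + 'm) \<Rightarrow> real ^ ('n + 'm)" where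
  "ode_order_1 f s z = - newton_dir f z"

definition ode_order_s ::
    "(real ^ ('n::finite + 'm::finite) \<Rightarrow> real) \<Rightarrow> real \<Rightarrow> real ^ ('n + 'm) \<Rightarrow> real ^ ('n + 'm)" where
  "ode_order_s f s z =
     - newton_dir f z +
     (s / 2) *\<^sub>R
       ((matrix (\<lambda>v. matrix_inv (jacobian (saddle_field f) z) *v
                      second_deriv (saddle_field f) z v (newton_dir f z)) - mat 1)
        *v newton_dir f z)"

text \<open>The step size \<open>s\<close> is both the parameter of the vector field \<open>W s\<close> and the time at which
  its solution is evaluated.  For a \<open>C\<^sup>1\<close> field the solution \<open>Z\<close> on \<open>[0, s]\<close> is unique.\<close>
definition one_step_consistent ::
    "nat \<Rightarrow> (real \<Rightarrow> 'a::euclidean_space \<Rightarrow> 'a) \<Rightarrow> (real \<Rightarrow> 'a \<Rightarrow> 'a) \<Rightarrow> bool" where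
  "one_step_consistent r w W \<longleftrightarrow>
     (\<forall>z0. \<exists>C\<ge>0. \<exists>s0>0. \<forall>s\<in>{0<..s0}. \<exists>Z :: real \<Rightarrow> 'a.
        Z 0 = z0 \<and>
        (\<forall>t\<in>{0..s}. (Z has_vector_derivative W s (Z t)) (at t within {0..s})) \<and>
        norm (Z s - w s z0) \<le> C * s ^ r)"

section \<open>Exponential stability of fixed points\<close>

definition stable_point :: "('a::euclidean_space \<Rightarrow> 'a) \<Rightarrow> 'a \<Rightarrow> bool" where
  "stable_point g ze \<longleftrightarrow>
     (\<forall>\<epsilon>>0. \<exists>\<delta>>0. \<forall>z0. norm (z0 - ze) < \<delta> \<longrightarrow> (\<forall>k. norm ((g ^^ k) z0 - ze) < \<epsilon>))"

definition exp_stable_equilibrium :: "('a::euclidean_space \<Rightarrow> 'a) \<Rightarrow> 'a \<Rightarrow> bool" where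
  "exp_stable_equilibrium g ze \<longleftrightarrow>
     g ze = ze \<and> stable_point g ze \<and>
     (\<exists>\<delta>>0. \<exists>M>0. \<exists>\<gamma>\<in>{0<..<1}. \<forall>z0. norm (z0 - ze) < \<delta> \<longrightarrow>
        (\<forall>k. norm ((g ^^ k) z0 - ze) \<le> M * norm (z0 - ze) * \<gamma> ^ k))"

end

theory Submission
  imports Defs
begin

text \<open>At a saddle point \<open>ze\<close> the field \<open>F\<close> vanishes, so \<open>\<nabla>F(z) N(z) = F(z) = \<nabla>F(ze)(z - ze) + o(|z - ze|)\<close>
  for the Newton direction \<open>N\<close>. As \<open>\<nabla>F\<close> is continuous with invertible values, \<open>N\<close> has derivative
  \<open>I\<close> at \<open>ze\<close>, the damped step has derivative \<open>(1 - s) I\<close>, and for \<open>0 < s < 1\<close> it is a local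
  contraction towards \<open>ze\<close>. Hence \<open>s_star = 1\<close> works for all saddle points at once.\<close>

section \<open>Exponential stability from the linearization\<close>

text \<open>Differentiability at \<open>ze\<close> alone bounds the distance to \<open>ze\<close>
  after one step by a factor below 1 on some ball. Points of the ball never leave it, so this
  one-step bound can be iterated.\<close>

lemma exp_stable_equilibrium_if_onorm_less_1:
  fixes g :: "'a::euclidean_space \<Rightarrow> 'a"
  assumes eq: "g ze = ze" and der: "(g has_derivative g') (at ze)" and less: "onorm g' < 1"
  shows "exp_stable_equilibrium g ze"
proof -
  \<comment> \<open>The midpoint between \<open>onorm g'\<close> and 1: the gap (1 -
    \<open>onorm g'\<close>) / 2 is the allowance for the remainder. It is positive even if
    \<open>g'\<close> is zero, as a rate in the open interval (0,1) must be.\<close>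
  define q where "q = (1 + onorm g') / 2"
  have bl: "bounded_linear g'"
    using der by (rule has_derivative_bounded_linear)
  have q: "0 < q" "q < 1" "onorm g' + (1 - onorm g') / 2 = q"
    using less onorm_pos_le[OF bl] by (auto simp: q_def field_simps)
  obtain d where d: "d > 0"
    "\<And>z. norm (z - ze) < d \<Longrightarrow> norm (g z - g ze - g' (z - ze)) \<le> (1 - onorm g') / 2 * norm (z - ze)"
    using der less unfolding has_derivative_at_alt
    by (metis diff_gt_0_iff_gt half_gt_zero)
  have contr: "norm (g z - ze) \<le> q * norm (z - ze)" if "norm (z - ze) < d" for z
  proof -
    have "norm (g z - ze) = norm (g' (z - ze) + (g z - g ze - g' (z - ze)))"
      by (simp add: eq)
    also have "\<dots> \<le> onorm g' * norm (z - ze) + (1 - onorm g') / 2 * norm (z - ze)"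
      by (intro norm_triangle_mono onorm[OF bl] d that)
    also have "\<dots> = q * norm (z - ze)"
      by (metis distrib_right q(3))
    finally show ?thesis .
  qed
  have iter: "norm ((g ^^ k) z - ze) \<le> norm (z - ze) * q ^ k" if "norm (z - ze) < d" for z k
  proof (induction k)
    case (Suc k)
    \<comment> \<open>Keeps the k-th iterate in the ball where \<open>contr\<close> applies.\<close>
    have "norm (z - ze) * q ^ k \<le> norm (z - ze) * 1"
      using q by (intro mult_left_mono power_le_one) auto
    then have "norm ((g ^^ k) z - ze) < d"
      using Suc that by linarith
    from contr[OF this] have "norm ((g ^^ Suc k) z - ze) \<le> q * norm ((g ^^ k) z - ze)"
      by simp
    also have "\<dots> \<le> q * (norm (z - ze) * q ^ k)"
      using Suc q by (intro mult_left_mono) auto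
    finally show ?case
      by (simp add: mult_ac)
  qed simp
  have "stable_point g ze"
    unfolding stable_point_def
  proof (intro allI impI)
    fix e :: real assume "e > 0"
    have "norm ((g ^^ k) z - ze) < e" if "norm (z - ze) < min d e" for z k
    proof -
      have "norm (z - ze) * q ^ k \<le> norm (z - ze) * 1"
        using q by (intro mult_left_mono power_le_one) auto
      then show ?thesis
        using iter[of z k] that by simp
    qed
    then show "\<exists>d>0. \<forall>z. norm (z - ze) < d \<longrightarrow> (\<forall>k. norm ((g ^^ k) z - ze) < e)"
      using \<open>e > 0\<close> \<open>d > 0\<close> by (intro exI[of _ "min d e"]) auto
  qed
  moreover have "\<exists>d>0. \<exists>M>0. \<exists>c\<in>{0<..<1}. \<forall>z. norm (z - ze) < d \<longrightarrow>
        (\<forall>k. norm ((g ^^ k) z - ze) \<le> M * norm (z - ze) * c ^ k)"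
    using iter d(1) q by (intro exI[of _ d] exI[of _ 1] conjI bexI[of _ q]) auto
  ultimately show ?thesis
    using eq by (simp add: exp_stable_equilibrium_def)
qed

section \<open>Derivative of the Newton direction at a zero of F\<close>

text \<open>In finite dimension the operator norm is at most the sum of the norms on basis vectors,
  so continuity for each fixed \<open>v\<close> becomes uniform in \<open>v\<close>. The uniformity
  matters because the bound is later used at \<open>v = N z\<close>, which moves with
  \<open>z\<close>.\<close>

lemma eventually_operator_close:
  fixes A :: "'c::t2_space \<Rightarrow> 'a::euclidean_space \<Rightarrow> 'b::real_normed_vector"
  assumes lin: "\<And>z. linear (A z)" and cont: "\<And>v. isCont (\<lambda>z. A z v) ze" and "e > 0"
  shows "eventually (\<lambda>z. \<forall>v. norm (A z v - A ze v) \<le> e * norm v) (nhds ze)"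
proof -
  have "((\<lambda>z. \<Sum>b\<in>Basis. norm (A z b - A ze b)) \<longlongrightarrow> (\<Sum>b\<in>Basis. norm (A ze b - A ze b))) (nhds ze)"
    by (intro tendsto_intros)
      (rule tendsto_at_iff_tendsto_nhds[of "\<lambda>z. A z _", THEN iffD1, OF cont[unfolded isCont_def]])
  then have "eventually (\<lambda>z. (\<Sum>b\<in>Basis. norm (A z b - A ze b)) < e) (nhds ze)"
    using \<open>e > 0\<close> by (intro order_tendstoD(2)) auto
  then show ?thesis
  proof eventually_elim
    case (elim z)
    show ?case
    proof
      fix v
      let ?B = "\<lambda>v. A z v - A ze v"
      have B: "linear ?B"
        using lin by (intro linear_compose_sub)
      have "?B v = ?B (\<Sum>b\<in>Basis. (v \<bullet> b) *\<^sub>R b)"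
        by (simp add: euclidean_representation)
      also have "\<dots> = (\<Sum>b\<in>Basis. (v \<bullet> b) *\<^sub>R ?B b)"
        unfolding linear_sum[OF B] linear_cmul[OF B] ..
      finally have "norm (?B v) = norm (\<Sum>b\<in>Basis. (v \<bullet> b) *\<^sub>R ?B b)"
        by (rule arg_cong)
      also have "\<dots> \<le> (\<Sum>b\<in>Basis. norm ((v \<bullet> b) *\<^sub>R ?B b))"
        by (rule norm_sum)
      also have "\<dots> \<le> (\<Sum>b\<in>Basis. norm v * norm (?B b))"
        by (intro sum_mono) (simp add: Basis_le_norm mult_right_mono)
      also have "\<dots> = (\<Sum>b\<in>Basis. norm (?B b)) * norm v"
        by (simp add: sum_distrib_left mult.commute)
      also have "\<dots> \<le> e * norm v"
        using elim by (intro mult_right_mono) auto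
      finally show "norm (?B v) \<le> e * norm v" .
    qed
  qed
qed

text \<open>The argument works with the linear system \<open>F' z (N z) = F z\<close> instead of
  differentiating an inverse matrix: the error \<open>N z - (z - ze)\<close> is controlled through
  its image under \<open>F' ze\<close>, which is bounded below by injectivity.\<close>

lemma newton_direction_has_derivative_id:
  fixes F :: "'a::euclidean_space \<Rightarrow> 'b::euclidean_space"
  assumes der: "(F has_derivative F' ze) (at ze)" and zero: "F ze = 0"
    and lin: "\<And>z. linear (F' z)" and cont: "\<And>v. isCont (\<lambda>z. F' z v) ze"
    and inj: "inj (F' ze)" and newton: "\<And>z. F' z (N z) = F z"
  shows "N ze = 0" and "(N has_derivative (\<lambda>h. h)) (at ze)"
proof -
  show N0: "N ze = 0"
    using newton[of ze] zero inj linear_0[OF lin] by (metis injD)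
  obtain c where c: "c > 0" "\<And>v. c * norm v \<le> norm (F' ze v)"
    using linear_inj_bounded_below_pos[OF lin inj] by metis
  show "(N has_derivative (\<lambda>h. h)) (at ze)"
    unfolding has_derivative_at_alt
  proof (intro conjI bounded_linear_ident allI impI)
    fix e :: real assume "e > 0"
    \<comment> \<open>chosen such that \<open>d \<le> c / 2\<close> and \<open>2 d \<le> e (c - d)\<close>\<close>
    define d where "d = min (c / 2) (e * c / 4)"
    have d: "d > 0" "d \<le> c / 2" "d \<le> e * c / 4"
      using mult_pos_pos[OF \<open>e > 0\<close> \<open>c > 0\<close>] \<open>c > 0\<close> unfolding d_def by linarith+
    obtain d1 where d1: "d1 > 0"
      "\<And>z. norm (z - ze) < d1 \<Longrightarrow> norm (F z - F ze - F' ze (z - ze)) \<le> d * norm (z - ze)"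
      using der d(1) unfolding has_derivative_at_alt by metis
    obtain d2 where d2: "d2 > 0"
      "\<And>z v. norm (z - ze) < d2 \<Longrightarrow> norm (F' z v - F' ze v) \<le> d * norm v"
      using eventually_operator_close[of F', OF lin cont d(1)]
      unfolding eventually_nhds_metric dist_norm by metis
    have "norm (N z - N ze - (z - ze)) \<le> e * norm (z - ze)" if "norm (z - ze) < min d1 d2" for z
    proof -
      define u where "u = N z - (z - ze)"
      \<comment> \<open>Inserting \<open>F z = F' z (N z)\<close> splits the image of the error into
        the Taylor remainder of \<open>F\<close> and the change of the derivative applied to
        \<open>N z\<close>.\<close>
      have "F' ze u = (F z - F ze - F' ze (z - ze)) - (F' z (N z) - F' ze (N z))"
        by (simp add: u_def linear_diff[OF lin] newton zero)
      then have "norm (F' ze u) \<le> d * norm (z - ze) + d * norm (N z)"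
        using that d1(2)[of z] d2(2)[of z "N z"]
          norm_triangle_ineq4[of "F z - F ze - F' ze (z - ze)" "F' z (N z) - F' ze (N z)"]
        by simp
      \<comment> \<open>The size of \<open>N z\<close> is not known yet. Bounding it by
        \<open>u\<close> creates a term \<open>d * norm u\<close>, which is absorbed on the left
        since \<open>d\<close> is at most \<open>c / 2\<close>.\<close>
      moreover have "d * norm (N z) \<le> d * (norm u + norm (z - ze))"
        using d(1) norm_triangle_ineq[of u "z - ze"] by (intro mult_left_mono) (auto simp: u_def)
      ultimately have "c * norm u \<le> 2 * d * norm (z - ze) + d * norm u"
        using c(2)[of u] by (simp add: algebra_simps)
      also have "\<dots> \<le> 2 * (e * c / 4) * norm (z - ze) + c / 2 * norm u"
        using d by (intro add_mono mult_right_mono) (auto simp: mult.commute)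
      finally have "c * norm u \<le> c * (e * norm (z - ze))"
        by (simp add: field_simps)
      then show ?thesis
        using c(1) by (simp add: u_def N0)
    qed
    then show "\<exists>d>0. \<forall>z. norm (z - ze) < d \<longrightarrow> norm (N z - N ze - (z - ze)) \<le> e * norm (z - ze)"
      using d1(1) d2(1) by (intro exI[of _ "min d1 d2"]) auto
  qed
qed

section \<open>Gradients of C^1 and C^2 functions\<close>

lemma GDERIV_iff:
  fixes f :: "'a::euclidean_space \<Rightarrow> real"
  shows "(GDERIV f z :> D) \<longleftrightarrow> f differentiable (at z) \<and> gradient f z = D"
proof -
  have unique: "D = E" if "GDERIV f z :> D" "GDERIV f z :> E" for D E
    using has_derivative_unique[OF that[unfolded gderiv_def]] vector_eq_rdot[of D E]
    by (simp add: fun_eq_iff inner_commute)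
  have "\<exists>D. GDERIV f z :> D" if f: "f differentiable (at z)"
  proof -
    obtain f' where f': "(f has_derivative f') (at z)"
      using f unfolding differentiable_def by blast
    \<comment> \<open>Riesz representation: the adjoint of a functional, evaluated at 1, is its
      representing vector.\<close>
    have "f' h = h \<bullet> adjoint f' 1" for h
      using adjoint_works[OF has_derivative_linear[OF f'], of h 1] by simp
    then show ?thesis
      using f' unfolding gderiv_def by (metis ext)
  qed
  then show ?thesis
    unfolding gradient_def
    by (metis gderiv_def differentiable_def the_equality unique)
qed

text \<open>\<open>C_k\<close> speaks of derivatives in fixed directions; this coordinate form
  carries that regularity over to the gradient.\<close>

lemma gradient_eq_sum:
  fixes f :: "'a::euclidean_space \<Rightarrow> real"
  assumes "f differentiable (at z)"
  shows "gradient f z = (\<Sum>b\<in>Basis. frechet_derivative f (at z) b *\<^sub>R b)"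
proof -
  have "(f has_derivative (\<lambda>h. h \<bullet> gradient f z)) (at z)"
    using assms GDERIV_iff gderiv_def by blast
  then have "frechet_derivative f (at z) = (\<lambda>h. h \<bullet> gradient f z)"
    by (metis frechet_derivative_at)
  then show ?thesis
    by (simp add: inner_commute[of _ "gradient f z"] euclidean_representation)
qed

lemma C_k_2_gradient:
  fixes f :: "'a::euclidean_space \<Rightarrow> real"
  assumes "C_k 2 f"
  shows "(gradient f has_derivative frechet_derivative (gradient f) (at z)) (at z)"
    and "continuous_on UNIV (\<lambda>z. frechet_derivative (gradient f) (at z) v)"
proof -
  define p where "p b z = frechet_derivative f (at z) b" for b z
  have f: "f differentiable (at z)"
    and p: "(p b) differentiable (at z)"
    and p': "continuous_on UNIV (\<lambda>z. frechet_derivative (p b) (at z) v)" for b z v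
    using assms by (auto simp: numeral_2_eq_2 p_def[abs_def])
  have grad: "gradient f = (\<lambda>z. \<Sum>b\<in>Basis. p b z *\<^sub>R b)"
    using gradient_eq_sum[OF f] by (auto simp: p_def)
  have der: "(gradient f has_derivative (\<lambda>v. \<Sum>b\<in>Basis. frechet_derivative (p b) (at z) v *\<^sub>R b)) (at z)" for z
    unfolding grad using p
    by (intro has_derivative_sum has_derivative_scaleR_left) (simp add: frechet_derivative_works)
  then have "frechet_derivative (gradient f) (at z) = (\<lambda>v. \<Sum>b\<in>Basis. frechet_derivative (p b) (at z) v *\<^sub>R b)" for z
    by (rule frechet_derivative_at[symmetric])
  then show "(gradient f has_derivative frechet_derivative (gradient f) (at z)) (at z)"
    and "continuous_on UNIV (\<lambda>z. frechet_derivative (gradient f) (at z) v)"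
    using der by (simp_all add: continuous_on_sum continuous_on_scaleR p')
qed

section \<open>The splitting into x- and y-blocks\<close>

lemma
  fixes z :: "real ^ ('n::finite + 'm::finite)"
  shows join_parts: "join (xpart z) (ypart z) = z"
    and xpart_join: "xpart (join x y) = x" and ypart_join: "ypart (join x y) = y"
  by (auto simp: join_def xpart_def ypart_def vec_eq_iff split: sum.split)

lemma inner_join: "join x y \<bullet> z = x \<bullet> xpart z + y \<bullet> ypart z"
proof -
  have "join x y \<bullet> z = (\<Sum>k\<in>UNIV <+> UNIV. join x y $ k * z $ k)"
    by (simp add: inner_vec_def)
  then show ?thesis
    by (subst (asm) sum.Plus) (auto simp: join_def xpart_def ypart_def inner_vec_def)
qed

lemma bounded_linear_join_0:
  "bounded_linear (\<lambda>x::real^'n::finite. join x (0::real^'m::finite))"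
  "bounded_linear (\<lambda>y::real^'m::finite. join (0::real^'n::finite) y)"
  by (auto simp: linear_conv_bounded_linear[symmetric] join_def vec_eq_iff
      intro!: linearI split: sum.split)

lemma join_has_derivative:
  fixes x :: "real^'n::finite" and y :: "real^'m::finite"
  shows "((\<lambda>x. join x y) has_derivative (\<lambda>h. join h 0)) (at x)"
    and "((\<lambda>y. join x y) has_derivative (\<lambda>h. join 0 h)) (at y)"
proof -
  have x: "(\<lambda>x::real^'n. join x y) = (\<lambda>x. join x 0 + join 0 y)"
    and y: "(\<lambda>y::real^'m. join x y) = (\<lambda>y. join 0 y + join x 0)"
    by (auto simp: join_def vec_eq_iff split: sum.split)
  show "((\<lambda>x. join x y) has_derivative (\<lambda>h. join h 0)) (at x)"
    unfolding x by (intro has_derivative_add_const)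
      (auto intro: bounded_linear_imp_has_derivative bounded_linear_join_0)
  show "((\<lambda>y. join x y) has_derivative (\<lambda>h. join 0 h)) (at y)"
    by (subst y, intro has_derivative_add_const)
      (auto intro: bounded_linear_imp_has_derivative bounded_linear_join_0)
qed

text \<open>Chain rule along an affine slice: by \<open>inner_join\<close>, pairing the gradient
  with \<open>join h 0\<close> or \<open>join 0 h\<close> leaves a single block of it.\<close>

lemma slice_GDERIV:
  fixes f :: "real ^ ('n::finite + 'm::finite) \<Rightarrow> real"
  assumes "f differentiable (at z)"
  shows "GDERIV (\<lambda>x. f (join x (ypart z))) (xpart z) :> xpart (gradient f z)"
    and "GDERIV (\<lambda>y. f (join (xpart z) y)) (ypart z) :> ypart (gradient f z)"
proof -
  have f: "(f has_derivative (\<lambda>h. h \<bullet> gradient f z)) (at (join (xpart z) (ypart z)))"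
    using assms GDERIV_iff unfolding gderiv_def join_parts by blast
  show "GDERIV (\<lambda>x. f (join x (ypart z))) (xpart z) :> xpart (gradient f z)"
    using has_derivative_compose[OF join_has_derivative(1) f]
    by (simp add: gderiv_def inner_join)
  show "GDERIV (\<lambda>y. f (join (xpart z) y)) (ypart z) :> ypart (gradient f z)"
    using has_derivative_compose[OF join_has_derivative(2) f]
    by (simp add: gderiv_def inner_join)
qed

lemma grad_x_grad_y_eq:
  assumes "f differentiable (at z)"
  shows "grad_x f z = xpart (gradient f z)" and "grad_y f z = ypart (gradient f z)"
  using slice_GDERIV[OF assms] by (simp_all add: grad_x_def grad_y_def GDERIV_iff)

section \<open>The saddle field as a reflected gradient\<close>

text \<open>The reflection diag(I, -I). Writing F as this linear involution after the gradient of
  \<open>f\<close> reduces questions on F and its Jacobian to the gradient and the Hessian.\<close>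

definition flip_y :: "real ^ ('n::finite + 'm::finite) \<Rightarrow> real ^ ('n + 'm)" where
  "flip_y z = join (xpart z) (- ypart z)"

lemma flip_y_flip_y: "flip_y (flip_y z) = z"
  by (simp add: flip_y_def xpart_join ypart_join join_parts)

lemma bounded_linear_flip_y: "bounded_linear flip_y"
  by (auto simp: linear_conv_bounded_linear[symmetric] flip_y_def join_def xpart_def ypart_def
      vec_eq_iff intro!: linearI split: sum.split)

lemma saddle_field_eq_flip_y:
  assumes "f differentiable (at z)"
  shows "saddle_field f z = flip_y (gradient f z)"
  by (simp add: saddle_field_def flip_y_def grad_x_grad_y_eq[OF assms])

lemma GDERIV_local_extremum:
  assumes "GDERIV f x :> D" "open U" "x \<in> U"
    and "(\<forall>y\<in>U. f x \<le> f y) \<or> (\<forall>y\<in>U. f y \<le> f x)"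
  shows "D = 0"
  using differential_zero_maxmin[OF assms(3,2) assms(1)[unfolded gderiv_def]] assms(4)
  by (metis inner_eq_zero_iff)

text \<open>Along the x-slice through \<open>z\<close> the function has a local minimum and along
  the y-slice a local maximum, so both blocks of the gradient vanish. The neighbourhoods in the
  slices are the preimages of \<open>U\<close>, open by continuity of \<open>join\<close> in each
  argument.\<close>

lemma saddle_point_saddle_field_0:
  fixes f :: "real ^ ('n::finite + 'm::finite) \<Rightarrow> real"
  assumes "saddle_point f z" and f: "f differentiable (at z)"
  shows "saddle_field f z = 0"
proof -
  obtain U where U: "open U" "z \<in> U"
    and ineq: "\<And>x y. join x y \<in> U \<Longrightarrow> f (join (xpart z) y) \<le> f z \<and> f z \<le> f (join x (ypart z))"
    using assms(1) unfolding saddle_point_def by blast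
  have cont: "continuous_on UNIV (\<lambda>x. join x (ypart z))" "continuous_on UNIV (\<lambda>y. join (xpart z) y)"
    using join_has_derivative by (blast intro: continuous_at_imp_continuous_on has_derivative_continuous)+
  have "xpart (gradient f z) = 0"
    using U ineq
    by (intro GDERIV_local_extremum[OF slice_GDERIV(1)[OF f] open_vimage[OF U(1) cont(1)]])
      (auto simp: join_parts)
  moreover have "ypart (gradient f z) = 0"
    using U ineq
    by (intro GDERIV_local_extremum[OF slice_GDERIV(2)[OF f] open_vimage[OF U(1) cont(2)]])
      (auto simp: join_parts)
  ultimately have "gradient f z = join 0 0"
    using join_parts[of "gradient f z"] by simp
  then have "gradient f z = 0"
    using linear_0[OF bounded_linear.linear[OF bounded_linear_join_0(1)]] by simp
  then show ?thesis
    using saddle_field_eq_flip_y[OF f] linear_0[OF bounded_linear.linear[OF bounded_linear_flip_y]]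
    by simp
qed

text \<open>A linear map commutes with differentiation, so the Jacobian of F is the reflected
  Hessian. These are the facts on F that the Newton direction lemma asks for.\<close>

lemma saddle_field_jacobian:
  fixes f :: "real ^ ('n::finite + 'm::finite) \<Rightarrow> real"
  assumes "C_k 2 f"
  shows "(saddle_field f has_derivative (\<lambda>v. jacobian (saddle_field f) z *v v)) (at z)"
    and "jacobian (saddle_field f) z *v v = flip_y (hessian f z *v v)"
    and "isCont (\<lambda>z. jacobian (saddle_field f) z *v v) z"
proof -
  let ?g' = "\<lambda>z. frechet_derivative (gradient f) (at z)"
  have f: "f differentiable (at z)" for z
    using assms by (simp add: numeral_2_eq_2)
  have F: "saddle_field f = (\<lambda>z. flip_y (gradient f z))"
    using saddle_field_eq_flip_y[OF f] by auto
  have der: "(saddle_field f has_derivative (\<lambda>v. flip_y (?g' z v))) (at z)" for z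
    unfolding F by (rule bounded_linear.has_derivative[OF bounded_linear_flip_y C_k_2_gradient(1)[OF assms]])
  have J: "jacobian (saddle_field f) z *v v = flip_y (?g' z v)" for z v
    unfolding jacobian_def frechet_derivative_at[OF der, symmetric]
    using matrix_works has_derivative_linear[OF der] by (simp add: linear_matrix_vector_mul_eq)
  show "(saddle_field f has_derivative (\<lambda>v. jacobian (saddle_field f) z *v v)) (at z)"
    using der by (simp add: J)
  show "jacobian (saddle_field f) z *v v = flip_y (hessian f z *v v)"
    using matrix_works has_derivative_linear[OF C_k_2_gradient(1)[OF assms]]
    by (simp add: J hessian_def jacobian_def[of "gradient f"] linear_matrix_vector_mul_eq)
  have "continuous_on UNIV (\<lambda>z. flip_y (?g' z v))"
    by (rule bounded_linear.continuous_on[OF bounded_linear_flip_y C_k_2_gradient(2)[OF assms]])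
  then show "isCont (\<lambda>z. jacobian (saddle_field f) z *v v) z"
    by (simp add: J continuous_on_eq_continuous_at)
qed

section \<open>Damped Newton at a saddle point\<close>

lemma matrix_inv_right:
  fixes A :: "'a::semiring_1 ^ 'n ^ 'm"
  assumes "invertible A"
  shows "A ** matrix_inv A = mat 1"
  using assms unfolding invertible_def matrix_inv_def by (rule someI2_ex) simp

lemma invertible_if_inj:
  fixes A :: "real ^ 'n ^ 'n"
  assumes "inj ((*v) A)"
  shows "invertible A"
  using assms by (meson invertible_left_inverse matrix_left_invertible_injective)

lemma newton_step_has_derivative_at_saddle:
  fixes f :: "real ^ ('n::finite + 'm::finite) \<Rightarrow> real"
  assumes C2: "C_k 2 f" and inv: "\<And>z. invertible (hessian f z)" and saddle: "saddle_point f z"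
  shows "newton_step f s z = z" and "(newton_step f s has_derivative (\<lambda>h. (1 - s) *\<^sub>R h)) (at z)"
proof -
  let ?J = "jacobian (saddle_field f)"
  \<comment> \<open>The reflection is its own inverse, so injectivity passes from the Hessian to the
    Jacobian of F.\<close>
  have inj: "inj ((*v) (?J z))" for z
  proof (rule injI)
    fix u v assume "?J z *v u = ?J z *v v"
    then have "hessian f z *v u = hessian f z *v v"
      using saddle_field_jacobian(2)[OF C2] flip_y_flip_y by metis
    then show "u = v"
      using inv[of z] by (metis inj_matrix_vector_mult injD)
  qed
  \<comment> \<open>Here \<open>matrix_inv\<close> is a genuine inverse at every \<open>z\<close>,
    so the Newton direction solves its linear system at all points around the saddle as
    well.\<close>
  have newton: "?J z *v newton_dir f z = saddle_field f z" for z
    using matrix_inv_right[OF invertible_if_inj[OF inj[of z]]]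
    by (simp add: newton_dir_def matrix_vector_mul_assoc)
  have F0: "saddle_field f z = 0"
    using saddle_point_saddle_field_0[OF saddle] C2 by (simp add: numeral_2_eq_2)
  note N = newton_direction_has_derivative_id[of "saddle_field f" "\<lambda>z v. ?J z *v v" z "newton_dir f",
      OF saddle_field_jacobian(1)[OF C2] F0 matrix_vector_mul_linear saddle_field_jacobian(3)[OF C2]
      inj newton]
  show "newton_step f s z = z"
    by (simp add: newton_step_def N(1))
  have "((\<lambda>z. z - s *\<^sub>R newton_dir f z) has_derivative (\<lambda>h. h - s *\<^sub>R h)) (at z)"
    by (intro has_derivative_diff has_derivative_ident has_derivative_scaleR_right N(2))
  then show "(newton_step f s has_derivative (\<lambda>h. (1 - s) *\<^sub>R h)) (at z)"
    by (simp add: newton_step_def[abs_def] scaleR_left_diff_distrib)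
qed

theorem corollary4p14:
  fixes f :: "real ^ ('n::finite + 'm::finite) \<Rightarrow> real"
    and L :: real and r :: nat
    and W :: "real \<Rightarrow> real ^ ('n + 'm) \<Rightarrow> real ^ ('n + 'm)"
  assumes "C_k 2 f"
    and "L > 0" and "L-lipschitz_on UNIV (gradient f)"
    and "\<And>z. invertible (hessian f z)"
    and "W = ode_order_1 f \<or> (C_k 3 f \<and> W = ode_order_s f)"
    and "\<And>s. s > 0 \<Longrightarrow> C_k 1 (newton_step f s)"
    and "\<And>s. s > 0 \<Longrightarrow> C_k 1 (W s)"
    and "r \<ge> 2" and "one_step_consistent r (newton_step f) W"
  shows "\<exists>s_star>0. \<forall>s\<in>{0<..<s_star}.
           {z. saddle_point f z} \<subseteq> {z. exp_stable_equilibrium (newton_step f s) z}"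
proof -
  have "exp_stable_equilibrium (newton_step f s) z" if "0 < s" "s < 1" "saddle_point f z" for s z
  proof (rule exp_stable_equilibrium_if_onorm_less_1)
    \<comment> \<open>The bound \<open>s < 1\<close> gives |1 - s| = 1 - s, and \<open>s > 0\<close>
      then puts this below 1.\<close>
    have "onorm (\<lambda>h::real ^ ('n + 'm). (1 - s) *\<^sub>R h) \<le> 1 - s"
      using that by (intro onorm_bound) auto
    then show "onorm (\<lambda>h::real ^ ('n + 'm). (1 - s) *\<^sub>R h) < 1"
      using that by simp
  qed (use newton_step_has_derivative_at_saddle[OF assms(1,4) that(3)] in auto)
  then show ?thesis
    by (intro exI[of _ 1]) auto
qed

end
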